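(* Let $\{s_k\}_{k\in\mathbb{Z}_+}$ be a sequence of complex numbers with $s_0=1$. Suppose that there is a real number $R>0$ such that $$|s_n|\le R^n,\qquad n\in\mathbb{Z}_+.$$ Then there exists a (non-negative) measure $\mu$ on $\mathfrak{B}(\mathbb{C})$ such that $$\int_{\mathbb{C}} z^k\,d\mu(z)=s_k,\qquad k\in\mathbb{Z}_+.$$ Moreover, $\mu$ can be chosen to have compact support.
   Context: $\mathbb{Z}_+$ denotes the set of non-negative integers, and $\mathfrak{B}(\mathbb{C})$ denotes the set of all Borel subsets of $\mathbb{C}$. Here $z^0=1$. *)

theory Defs
  imports "HOL-Analysis.Analysis"
begin

text \<open>The topological support of a measure: the points all of whose open neighbourhoods
  have positive measure.\<close>

definition measure_support :: "'a::topological_space measure \<Rightarrow> 'a set" where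
  "measure_support M = {x. \<forall>U. open U \<longrightarrow> x \<in> U \<longrightarrow> emeasure M U > 0}"

lemma closed_measure_support:
  fixes M :: "'a::topological_space measure"
  shows "closed (measure_support M)"
proof -
  have "- measure_support M = \<Union>{U. open U \<and> emeasure M U = 0}"
    by (auto simp: measure_support_def zero_less_iff_neq_zero)
  then have "open (- measure_support M)" by (metis (no_types, lifting) mem_Collect_eq open_Union)
  then show ?thesis by (simp add: closed_def)
qed

text \<open>In a second-countable space a Borel measure vanishes off its support, so a compact support
  means exactly that the measure is concentrated on some compact set.\<close>

lemma emeasure_Compl_measure_support:
  fixes M :: "'a::second_countable_topology measure"
  assumes "sets M = sets borel"
  shows "emeasure M (- measure_support M) = 0"
proof -
  define F where "F = {U. open U \<and> emeasure M U = 0}"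
  have "- measure_support M = \<Union>F"
    by (auto simp: measure_support_def F_def zero_less_iff_neq_zero)
  moreover obtain F' where "F' \<subseteq> F" "countable F'" "\<Union>F' = \<Union>F"
    by (rule Lindelof[of F]) (auto simp: F_def)
  moreover have "(\<Union>U\<in>F'. U) \<in> null_sets M"
    using \<open>countable F'\<close> \<open>F' \<subseteq> F\<close> assms
    by (intro null_sets_UN') (auto simp: F_def null_sets_def)
  ultimately show ?thesis by (simp add: null_sets_def)
qed

lemma compact_measure_support_iff:
  fixes M :: "'a::{second_countable_topology, t2_space} measure"
  assumes "sets M = sets borel"
  shows "compact (measure_support M) \<longleftrightarrow> (\<exists>K. compact K \<and> emeasure M (- K) = 0)"
proof
  assume "compact (measure_support M)"
  then show "\<exists>K. compact K \<and> emeasure M (- K) = 0"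
    using emeasure_Compl_measure_support[OF assms] by blast
next
  assume "\<exists>K. compact K \<and> emeasure M (- K) = 0"
  then obtain K where K: "compact K" "emeasure M (- K) = 0" by blast
  have "open (- K)" using K(1) by (simp add: compact_imp_closed open_Compl)
  then have "measure_support M \<subseteq> K" using K(2) by (force simp: measure_support_def)
  then have "K \<inter> measure_support M = measure_support M" by blast
  then show "compact (measure_support M)"
    using compact_Int_closed[OF K(1) closed_measure_support[of M]] by simp
qed

end

theory Submission
  imports Defs
begin

text \<open>On the circle of radius \<open>3 * R\<close>, parametrised by \<open>z = 3 * R * cis t\<close>, take the density
  \<open>(1 + 2 Re (\<Sum>n\<ge>1. s n * z ^ (- n))) / (2 * pi)\<close>. Its Fourier coefficients are the required
  moments, and it is nonnegative because the series is bounded by \<open>\<Sum>n\<ge>1. 3 ^ (- n) = 1 / 2\<close>.\<close>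

abbreviation angle_measure :: "real measure" where
  "angle_measure \<equiv> restrict_space lborel {0..2 * pi}"

lemma finite_measure_angle: "finite_measure angle_measure"
  by (rule finite_measureI) (simp add: emeasure_restrict_space space_restrict_space)

lemma borel_measurable_angle:
  fixes f :: "real \<Rightarrow> 'a::topological_space"
  assumes "continuous_on UNIV f"
  shows "f \<in> borel_measurable angle_measure"
  using borel_measurable_continuous_onI[OF assms] by (simp add: measurable_restrict_space1)

lemma integrable_angle_cis: "integrable angle_measure (\<lambda>t. cis (a * t))"
  by (rule finite_measure.integrable_const_bound[OF finite_measure_angle, of _ 1])
    (auto intro!: borel_measurable_angle continuous_intros)

text \<open>For \<open>m \<noteq> 0\<close> the antiderivative \<open>F\<close> is periodic with
  period \<open>2 * pi\<close>, so its endpoint values cancel; for \<open>m = 0\<close> the integral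
  is the length of the interval. This orthogonality later isolates single coefficients of the
  series.\<close>

lemma integral_angle_cis:
  "(\<integral>t. cis (of_int m * t) \<partial>angle_measure) = (if m = 0 then of_real (2 * pi) else 0)"
proof (cases "m = 0")
  case True
  then show ?thesis
    by (simp add: measure_restrict_space space_restrict_space scaleR_conv_of_real)
next
  case False
  define F where "F t = cis (of_int m * t) / (\<i> * of_int m)" for t
  have "(F has_vector_derivative cis (of_int m * t)) (at t within {0..2 * pi})" for t
  proof -
    \<comment> \<open>Differentiate over the complex plane, where the rules for \<open>exp\<close>
      apply, then restrict to the real line.\<close>
    have "((\<lambda>w. exp (\<i> * (of_int m * w)) / (\<i> * of_int m)) has_field_derivative
        exp (\<i> * (of_int m * of_real t))) (at (of_real t))"
      using False by (auto intro!: derivative_eq_intros simp: mult.commute[of _ \<i>])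
    from has_vector_derivative_real_field[OF this] show ?thesis
      by (simp add: F_def[abs_def] cis_conv_exp)
  qed
  moreover have "continuous_on {0..2 * pi} (\<lambda>t. cis (of_int m * t))"
    by (intro continuous_intros)
  ultimately have "has_bochner_integral lborel
      (\<lambda>t. indicator {0..2 * pi} t *\<^sub>R cis (of_int m * t)) (F (2 * pi) - F 0)"
    by (intro has_bochner_integral_FTC_Icc) auto
  moreover have "cis (of_int m * (2 * pi)) = 1"
    using cis_multiple_2pi[of "of_int m"] by (simp add: mult.commute mult.left_commute)
  ultimately show ?thesis
    using False by (simp add: integral_restrict_space F_def has_bochner_integral_integral_eq)
qed

text \<open>Since \<open>2 * Re w = w + cnj w\<close>, the integrand splits into exponentials of
  frequencies \<open>k - n\<close> and \<open>k + n\<close>. For \<open>n > 0\<close> the second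
  frequency is positive and integrates to zero; the first one vanishes only when
  \<open>k = n\<close>.\<close>

lemma integral_angle_Re_cis:
  fixes a :: complex and k n :: nat
  shows "integrable angle_measure (\<lambda>t. of_real (2 * Re (a * cis (- (real n * t)))) * cis (real k * t))"
    and "n > 0 \<Longrightarrow>
      (\<integral>t. of_real (2 * Re (a * cis (- (real n * t)))) * cis (real k * t) \<partial>angle_measure)
        = (if k = n then 2 * pi * a else 0)"
proof -
  have eq: "of_real (2 * Re (a * cis (- (real n * t)))) * cis (real k * t)
      = a * cis (of_int (int k - int n) * t) + cnj a * cis (of_int (int k + int n) * t)" for t
    unfolding complex_add_cnj[symmetric]
    by (simp add: cis_cnj distrib_right mult.assoc cis_mult algebra_simps)
  show "integrable angle_measure (\<lambda>t. of_real (2 * Re (a * cis (- (real n * t)))) * cis (real k * t))"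
    unfolding eq by (intro Bochner_Integration.integrable_add integrable_mult_right integrable_angle_cis)
  show "(\<integral>t. of_real (2 * Re (a * cis (- (real n * t)))) * cis (real k * t) \<partial>angle_measure)
      = (if k = n then 2 * pi * a else 0)" if "n > 0"
    unfolding eq using that
    by (simp add: integrable_angle_cis integral_angle_cis del: of_int_add of_int_diff)
qed

text \<open>This is the moment problem rescaled to the unit circle, to be applied to
  \<open>c n = s n / r ^ n\<close>. The density is a Fourier series with coefficients
  \<open>c n\<close>, dominated by its constant term.\<close>

lemma circle_density:
  fixes c :: "nat \<Rightarrow> complex"
  assumes c: "\<And>n. norm (c n) \<le> (1 / 3) ^ n" and c0: "c 0 = 1"
  obtains h :: "real \<Rightarrow> real" where "h \<in> borel_measurable angle_measure" "\<And>t. h t \<ge> 0"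
    "\<And>k. integrable angle_measure (\<lambda>t. h t *\<^sub>R cis (real k * t))"
    "\<And>k. (\<integral>t. h t *\<^sub>R cis (real k * t) \<partial>angle_measure) = c k"
proof -
  \<comment> \<open>The index is shifted because the constant term enters only once, as the
    \<open>1\<close> in \<open>h\<close>, whereas each later coefficient occurs together with its
    conjugate, hence the factor 2.\<close>
  define d where "d n t = 2 * Re (c (Suc n) * cis (- (real (Suc n) * t)))" for n t
  define h where "h t = (1 + (\<Sum>n. d n t)) / (2 * pi)" for t
  have d_bound: "\<bar>d n t\<bar> \<le> 2 / 3 * (1 / 3) ^ n" for n t
  proof -
    have "\<bar>d n t\<bar> \<le> 2 * norm (c (Suc n) * cis (- (real (Suc n) * t)))"
      unfolding d_def abs_mult by (intro mult_mono abs_Re_le_cmod) auto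
    also have "\<dots> \<le> 2 * (1 / 3) ^ Suc n"
      using c[of "Suc n"] by (simp add: norm_mult)
    finally show ?thesis by simp
  qed
  \<comment> \<open>This explains the ratio 1/3: the sum of \<open>2 * q ^ n\<close> over
    \<open>n \<ge> 1\<close> is \<open>2 * q / (1 - q)\<close>, which reaches 1 at
    \<open>q = 1 / 3\<close>, so the constant term of \<open>h\<close> still compensates the
    series.\<close>
  have geo: "(\<lambda>n. 2 / 3 * (1 / 3) ^ n) sums (1::real)"
    using sums_mult[OF geometric_sums[of "1 / 3 :: real"], of "2 / 3"] by simp
  have abs_summable: "summable (\<lambda>n. \<bar>d n t\<bar>)" for t
    using d_bound by (intro summable_comparison_test'[OF sums_summable[OF geo], of 0]) auto
  have d_meas: "d n \<in> borel_measurable angle_measure" for n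
    unfolding d_def
    by (intro borel_measurable_angle continuous_intros)
  have moment: "integrable angle_measure (\<lambda>t. h t *\<^sub>R cis (real k * t))
      \<and> (\<integral>t. h t *\<^sub>R cis (real k * t) \<partial>angle_measure) = c k" for k
  proof -
    let ?f = "\<lambda>n t. of_real (d n t) * cis (real k * t)"
    have int: "integrable angle_measure (?f n)" for n
      unfolding d_def by (rule integral_angle_Re_cis)
    have val: "(\<integral>t. ?f n t \<partial>angle_measure) = (if Suc n = k then 2 * pi * c k else 0)" for n
      unfolding d_def by (subst integral_angle_Re_cis) auto
    have ae: "AE t in angle_measure. summable (\<lambda>n. norm (?f n t))"
      using abs_summable by (simp add: norm_mult)
    \<comment> \<open>Summability of the L1 norms permits integrating the series term by
      term.\<close>
    have "summable (\<lambda>n. \<integral>t. norm (?f n t) \<partial>angle_measure)"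
    proof (rule summable_comparison_test')
      show "summable (\<lambda>n. measure angle_measure (space angle_measure) * (2 / 3 * (1 / 3) ^ n))"
        by (intro summable_mult sums_summable[OF geo])
      fix n
      have "(\<integral>t. norm (?f n t) \<partial>angle_measure) \<le> (\<integral>t. 2 / 3 * (1 / 3) ^ n \<partial>angle_measure)"
        using d_bound int finite_measure.integrable_const[OF finite_measure_angle]
        by (intro integral_mono integrable_norm) (auto simp: norm_mult)
      then show "norm (\<integral>t. norm (?f n t) \<partial>angle_measure)
          \<le> measure angle_measure (space angle_measure) * (2 / 3 * (1 / 3) ^ n)"
        by simp
    qed
    note series = integrable_suminf[OF int ae this] sums_integral[OF int ae this]
    \<comment> \<open>No index \<open>Suc n\<close> equals 0, so for \<open>k = 0\<close> the series
      contributes nothing: that moment comes from the constant term alone and matches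
      \<open>c 0\<close> by \<open>c0\<close>.\<close>
    have "(\<lambda>n. \<integral>t. ?f n t \<partial>angle_measure) sums (if k = 0 then 0 else 2 * pi * c k)"
    proof (cases k)
      case 0
      then show ?thesis unfolding val by simp
    next
      case (Suc m)
      then show ?thesis
        using sums_single[of m "\<lambda>_. 2 * pi * c k"] unfolding val by (simp add: if_distrib eq_commute)
    qed
    from sums_unique2[OF series(2) this]
    have sum: "(\<integral>t. (\<Sum>n. ?f n t) \<partial>angle_measure) = (if k = 0 then 0 else 2 * pi * c k)" .
    have eq: "h t *\<^sub>R cis (real k * t)
        = (cis (real k * t) + (\<Sum>n. ?f n t)) / of_real (2 * pi)" for t
    proof -
      have "summable (\<lambda>n. d n t)"
        using abs_summable by (rule summable_rabs_cancel)
      then show ?thesis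
        unfolding h_def
        by (simp add: suminf_mult2[symmetric] suminf_of_real[symmetric] summable_of_real
            scaleR_conv_of_real distrib_right)
    qed
    show ?thesis
      unfolding eq
      using integral_angle_cis[of "int k"] sum c0 series(1) integrable_angle_cis[of "real k"]
      by auto
  qed
  show thesis
  proof (rule that[of h])
    show "h \<in> borel_measurable angle_measure"
      unfolding h_def using d_meas by measurable
    show "h t \<ge> 0" for t
    proof -
      have "\<bar>\<Sum>n. d n t\<bar> \<le> (\<Sum>n. \<bar>d n t\<bar>)"
        by (rule summable_rabs[OF abs_summable])
      also have "\<dots> \<le> 1"
        using suminf_le[OF d_bound abs_summable sums_summable[OF geo]] sums_unique[OF geo] by simp
      finally show ?thesis
        unfolding h_def by simp
    qed
  qed (use moment in auto)
qed

theorem theorem2: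
  fixes s :: "nat \<Rightarrow> complex" and R :: real
  assumes "s 0 = 1"
    and "R > 0"
    and "\<And>n. norm (s n) \<le> R ^ n"
  shows "\<exists>\<mu> :: complex measure. sets \<mu> = sets borel
    \<and> (\<forall>k. integrable \<mu> (\<lambda>z. z ^ k) \<and> (\<integral>z. z ^ k \<partial>\<mu>) = s k)
    \<and> compact (measure_support \<mu>)"
proof -
  define r where "r = 3 * R"
  have r: "r > 0" using assms(2) by (simp add: r_def)
  have "norm (s n / of_real r ^ n) \<le> (1 / 3) ^ n" for n
    using assms(2) assms(3)[of n]
    by (simp add: r_def norm_divide norm_mult norm_power power_mult_distrib power_divide field_simps)
  then obtain h :: "real \<Rightarrow> real" where
    h [measurable]: "h \<in> borel_measurable angle_measure" and h_nonneg: "\<And>t. h t \<ge> 0"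
    and h_int: "\<And>k. integrable angle_measure (\<lambda>t. h t *\<^sub>R cis (real k * t))"
    and h_val: "\<And>k. (\<integral>t. h t *\<^sub>R cis (real k * t) \<partial>angle_measure) = s k / of_real r ^ k"
    using circle_density[of "\<lambda>n. s n / of_real r ^ n"] assms(1) by auto
  define z where "z t = of_real r * cis t" for t
  have z [measurable]: "z \<in> borel_measurable angle_measure"
    unfolding z_def
    by (intro borel_measurable_angle continuous_intros)
  have z_pow: "z t ^ k = of_real r ^ k * cis (real k * t)" for t k
    by (simp add: z_def power_mult_distrib Complex.DeMoivre)
  \<comment> \<open>Here \<open>h\<close> is coerced to \<open>ennreal\<close>, which cuts negative
    values to 0; \<open>h_nonneg\<close> ensures that integrals against \<open>\<nu>\<close> are
    integrals against \<open>h\<close> itself.\<close>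
  define \<nu> where "\<nu> = density angle_measure h"
  have z\<nu>: "z \<in> measurable \<nu> borel"
    unfolding \<nu>_def by simp
  define \<mu> where "\<mu> = distr \<nu> borel z"
  have "integrable \<mu> (\<lambda>z. z ^ k) \<and> (\<integral>z. z ^ k \<partial>\<mu>) = s k" for k
  proof -
    have zk: "(\<lambda>t. z t ^ k) \<in> borel_measurable angle_measure"
      by measurable
    \<comment> \<open>The factor \<open>r ^ k\<close> cancels the denominator in
      \<open>h_val\<close>, which turns the Fourier coefficient into \<open>s k\<close>.\<close>
    have eq: "h t *\<^sub>R z t ^ k = of_real r ^ k * (h t *\<^sub>R cis (real k * t))" for t
      by (simp add: z_pow)
    have "integrable \<nu> (\<lambda>t. z t ^ k)"
      unfolding \<nu>_def using h_int[of k] h_nonneg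
      by (subst integrable_density[OF zk h]) (simp_all only: eq integrable_mult_right AE_I2)
    moreover have "(\<integral>t. z t ^ k \<partial>\<nu>) = s k"
      unfolding \<nu>_def using h_val[of k] h_int[of k] h_nonneg r
      by (subst integral_density[OF zk h]) (simp_all add: eq AE_I2 del: mult_scaleR_right)
    ultimately show ?thesis
      unfolding \<mu>_def by (subst integrable_distr_eq[OF z\<nu>], simp, subst integral_distr[OF z\<nu>]) simp_all
  qed
  \<comment> \<open>All values of \<open>z\<close> lie on the circle of radius \<open>r\<close>, so
    the closed disc carries all the mass; one compact set of this kind is enough for compact
    support.\<close>
  moreover have "emeasure \<mu> (- cball 0 r) = 0"
  proof -
    have "z -` (- cball 0 r) = {}"
      using r by (auto simp: z_def norm_mult)
    then show ?thesis
      unfolding \<mu>_def by (subst emeasure_distr[OF z\<nu>]) auto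
  qed
  moreover have "sets \<mu> = sets borel"
    by (simp add: \<mu>_def)
  ultimately show ?thesis
    using compact_measure_support_iff compact_cball by blast
qed

end
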